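(* Work over the semifield $\mathbb{R}_{\max,+}$ and let $n\geq1$. Let $\mathbf{C}\in\mathbb{R}_{\max,+}^{n\times n}$ be a column-regular matrix. Consider the problem of minimizing $\mathbf{1}^{T}\mathbf{C}\mathbf{x}\mathbf{x}^{-}\mathbf{1}$ over all regular vectors $\mathbf{x}$ (i.e. $\mathbf{x}\in\mathbb{R}^{n}$). Then the minimum value in this problem is equal to $$\Delta=\mathbf{1}^{T}\mathbf{C}\mathbf{1}=\|\mathbf{C}\|,$$ and all regular solutions of the problem are given by $$\alpha\mathbf{1}\leq\mathbf{x}\leq\alpha\Delta(\mathbf{1}^{T}\mathbf{C})^{-},\qquad \alpha\in\mathbb{R},$$ or, equivalently, by $$\mathbf{x}=(\mathbf{I}\oplus\Delta^{-1}\mathbf{1}\mathbf{1}^{T}\mathbf{C})\mathbf{u},\qquad \mathbf{u}\in\mathbb{R}^{n}.$$ That is, a regular $\mathbf{x}$ attains the minimum if and only if the double inequality holds for some $\alpha\in\mathbb{R}$, and if and only if $\mathbf{x}$ has the latter form for some $\mathbf{u}\in\mathbb{R}^{n}$.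
   Context: $\mathbb{R}_{\max,+}=(\mathbb{R}\cup\{-\infty\},\max,+,-\infty,0)$ is the max-plus semifield: $\oplus=\max$, $\otimes=+$ (multiplication sign omitted, so $\alpha\Delta$ means $\alpha+\Delta$), zero $\mathbb{0}=-\infty$, one $\mathbb{1}=0$, and $x^{-1}=-x$ for $x\in\mathbb{R}$; the order is the usual one. All matrix/vector operations follow the usual rules with these $\oplus,\otimes$; inequalities are componentwise. $\mathbf{1}=(0,\ldots,0)^{T}$ is the column vector of $n$ zeros; $\mathbf{I}$ is the identity matrix ($0$ on the diagonal, $-\infty$ elsewhere). A vector is regular if none of its entries is $-\infty$; a matrix is column-regular if it has no column consisting entirely of $-\infty$. For a nonzero vector (not all entries $-\infty$), the conjugate transpose $\mathbf{x}^{-}$ of a column (row) vector $\mathbf{x}$ is the row (column) vector with entries $-x_{i}$ if $x_{i}\neq-\infty$ and $-\infty$ otherwise. $\|\mathbf{A}\|=\bigoplus_{i,j}a_{ij}$ is the maximum entry of $\mathbf{A}$. In ordinary notation, the objective is $\max_{i,j}(c_{ij}+x_{j})+\max_{k}(-x_{k})$. *)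

theory Defs
  imports "HOL-Analysis.Finite_Cartesian_Product"
begin

text \<open>
  The max-plus semifield. Semiring addition is the maximum and semiring multiplication is
  addition of reals, so \<open>0\<close> denotes minus infinity and \<open>1\<close> denotes the real number zero.
  With this instance, the library operations \<open>**\<close>, \<open>*v\<close>, \<open>v*\<close>, \<open>*s\<close>, \<open>mat\<close>, \<open>scalar_product\<close>
  and \<open>+\<close> on \<open>maxplus ^ 'n\<close> are the max-plus ones, and \<open>1 :: maxplus ^ 'n\<close> is the vector all
  of whose entries are the real number zero.
\<close>

datatype maxplus = NegInf | Fin real

instantiation maxplus :: linorder
begin

fun less_eq_maxplus :: "maxplus \<Rightarrow> maxplus \<Rightarrow> bool" where
  "NegInf \<le> y \<longleftrightarrow> True"
| "Fin a \<le> NegInf \<longleftrightarrow> False"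
| "Fin a \<le> Fin b \<longleftrightarrow> a \<le> b"

definition less_maxplus :: "maxplus \<Rightarrow> maxplus \<Rightarrow> bool" where
  "x < y \<longleftrightarrow> x \<le> y \<and> \<not> y \<le> x" for x y :: maxplus

instance
proof
  fix x y z :: maxplus
  show "x < y \<longleftrightarrow> x \<le> y \<and> \<not> y \<le> x"
    by (rule less_maxplus_def)
  show "x \<le> x"
    by (cases x) auto
  show "x \<le> y \<Longrightarrow> y \<le> z \<Longrightarrow> x \<le> z"
    by (cases x; cases y; cases z) auto
  show "x \<le> y \<Longrightarrow> y \<le> x \<Longrightarrow> x = y"
    by (cases x; cases y) auto
  show "x \<le> y \<or> y \<le> x"
    by (cases x; cases y) auto
qed

end

instantiation maxplus :: comm_semiring_1
begin

definition zero_maxplus :: maxplus where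
  "0 = NegInf"

definition one_maxplus :: maxplus where
  "1 = Fin 0"

definition plus_maxplus :: "maxplus \<Rightarrow> maxplus \<Rightarrow> maxplus" where
  "x + y = max x y" for x y :: maxplus

fun times_maxplus :: "maxplus \<Rightarrow> maxplus \<Rightarrow> maxplus" where
  "Fin a * Fin b = Fin (a + b)"
| "NegInf * y = NegInf"
| "x * NegInf = NegInf"

instance
proof
  fix x y z :: maxplus
  show "x + y + z = x + (y + z)"
    by (simp add: plus_maxplus_def max.assoc)
  show "x + y = y + x"
    by (simp add: plus_maxplus_def max.commute)
  show "0 + x = x"
    by (simp add: plus_maxplus_def zero_maxplus_def max_def)
  show "x * y * z = x * (y * z)"
    by (cases x; cases y; cases z) auto
  show "x * y = y * x"
    by (cases x; cases y) auto
  show "1 * x = x"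
    by (cases x) (auto simp: one_maxplus_def)
  show "(x + y) * z = x * z + y * z"
    by (cases x; cases y; cases z) (auto simp: plus_maxplus_def max_def)
  show "0 * x = 0" "x * 0 = 0"
    by (cases x; simp add: zero_maxplus_def)+
  show "(0 :: maxplus) \<noteq> 1"
    by (simp add: zero_maxplus_def one_maxplus_def)
qed

end

text \<open>The value of \<open>inverse\<close> at minus infinity is only a convention.\<close>

instantiation maxplus :: inverse
begin

fun inverse_maxplus :: "maxplus \<Rightarrow> maxplus" where
  "inverse (Fin a) = Fin (- a)"
| "inverse NegInf = NegInf"

definition divide_maxplus :: "maxplus \<Rightarrow> maxplus \<Rightarrow> maxplus" where
  "x div y = x * inverse y" for x y :: maxplus

instance ..

end

text \<open>Regular vectors are the embedded real vectors.\<close>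

definition regular :: "maxplus ^ 'n \<Rightarrow> bool" where
  "regular x \<longleftrightarrow> (\<forall>i. x $ i \<noteq> 0)"

definition column_regular :: "maxplus ^ 'n ^ 'm \<Rightarrow> bool" where
  "column_regular A \<longleftrightarrow> (\<forall>j. \<exists>i. A $ i $ j \<noteq> 0)"

text \<open>
  The library type of vectors does not distinguish rows from columns, so the conjugate
  transpose only acts on the entries; the orientation is fixed by the product it occurs in.
\<close>

definition conj_transpose :: "maxplus ^ 'n \<Rightarrow> maxplus ^ 'n" where
  "conj_transpose x = (\<chi> i. if x $ i \<noteq> 0 then inverse (x $ i) else 0)"

text \<open>Product of a column vector \<open>x\<close> with a row vector \<open>y\<close>.\<close>

definition outer_product :: "maxplus ^ 'm \<Rightarrow> maxplus ^ 'n \<Rightarrow> maxplus ^ 'n ^ 'm" where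
  "outer_product x y = (\<chi> i j. x $ i * y $ j)"

definition mp_norm :: "maxplus ^ 'n ^ 'm \<Rightarrow> maxplus" where
  "mp_norm A = (\<Sum>i\<in>UNIV. \<Sum>j\<in>UNIV. A $ i $ j)"

text \<open>The scalar \<open>1\<^sup>T C x x\<^sup>- 1\<close>.\<close>

definition objective :: "maxplus ^ 'n ^ 'n \<Rightarrow> maxplus ^ 'n \<Rightarrow> maxplus" where
  "objective C x = scalar_product 1 ((C ** outer_product x (conj_transpose x)) *v 1)"

lemma sum_maxplus_eq_Max:
  fixes f :: "'a \<Rightarrow> maxplus"
  assumes "finite A" "A \<noteq> {}"
  shows "sum f A = Max (f ` A)"
  using assms
proof (induction A rule: finite_ne_induct)
  case (singleton x)
  show ?case by simp
next
  case (insert x F)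
  then show ?case by (simp add: plus_maxplus_def)
qed

lemma mp_norm_eq_Max:
  "mp_norm A = Max (range (\<lambda>(i, j). A $ i $ j))"
proof -
  have "mp_norm A = (\<Sum>(i, j)\<in>UNIV. A $ i $ j)"
    by (simp add: mp_norm_def sum.cartesian_product)
  then show ?thesis
    by (simp add: sum_maxplus_eq_Max)
qed

end

theory Submission
  imports Defs
begin

text \<open>
  Write \<open>c = 1\<^sup>T C\<close> for the row of column maxima; column regularity says exactly that every
  \<open>c\<^sub>j\<close> is finite, and \<open>\<Delta>\<close> is the largest of them. The objective enters the argument only
  through \<open>c\<close>, because it factors as \<open>(\<Sum>\<^sub>j c\<^sub>j x\<^sub>j) (\<Sum>\<^sub>k x\<^sub>k\<inverse>)\<close>. As a max-plus sum lies below a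
  bound iff all its terms do, the objective is at most \<open>d\<close> iff \<open>c\<^sub>j x\<^sub>j \<le> d x\<^sub>k\<close> for all \<open>j\<close>
  and \<open>k\<close> (lemma \<open>objective_le_iff\<close>). The case \<open>j = k\<close> gives \<open>c\<^sub>j \<le> d\<close>, so \<open>\<Delta>\<close> is a lower
  bound; it is attained at the vector \<open>1\<close>, where the condition for \<open>d = \<Delta>\<close> reads \<open>c\<^sub>j \<le> \<Delta>\<close>.

  The minimizers are therefore the regular solutions of the system \<open>c\<^sub>j x\<^sub>j \<le> \<Delta> x\<^sub>k\<close>. Both
  descriptions come from eliminating one of the two indices. Inserting a number \<open>\<alpha>\<close> with
  \<open>c\<^sub>j x\<^sub>j \<le> \<Delta> \<alpha>\<close> and \<open>\<alpha> \<le> x\<^sub>k\<close> separates the indices, which is the double inequality; the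
  least entry of \<open>x\<close> serves as \<open>\<alpha>\<close>. Taking the maximum over \<open>j\<close> instead turns the system
  into \<open>\<Delta>\<inverse> 1 1\<^sup>T C x \<le> x\<close>, so that \<open>x\<close> is a fixed point of \<open>I \<oplus> \<Delta>\<inverse> 1 1\<^sup>T C\<close>. Conversely
  every vector in the image of this matrix satisfies the system, because \<open>c\<^sub>j \<le> \<Delta>\<close> makes the
  matrix idempotent.
\<close>

section \<open>Order and inverses in the max-plus semifield\<close>

lemma maxplus_zero_le [simp]: "0 \<le> (a::maxplus)"
  by (simp add: zero_maxplus_def)

lemma maxplus_le_zero_iff [simp]: "(a::maxplus) \<le> 0 \<longleftrightarrow> a = 0"
  by (cases a) (auto simp: zero_maxplus_def)

lemma maxplus_Fin_neq_zero [simp]: "Fin r \<noteq> 0"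
  by (simp add: zero_maxplus_def)

lemma maxplus_nonzeroE:
  assumes "(a::maxplus) \<noteq> 0"
  obtains r where "a = Fin r"
  using assms by (cases a) (auto simp: zero_maxplus_def)

lemma maxplus_add_le_iff: "a + b \<le> c \<longleftrightarrow> a \<le> c \<and> b \<le> (c::maxplus)"
  by (simp add: plus_maxplus_def)

text \<open>
  Sums are least upper bounds. The index set may be empty because \<open>0\<close> is the least element.
\<close>

lemma maxplus_sum_le_iff:
  fixes f :: "'a \<Rightarrow> maxplus"
  assumes "finite A"
  shows "sum f A \<le> b \<longleftrightarrow> (\<forall>a\<in>A. f a \<le> b)"
  using assms by (induction A rule: finite_induct) (auto simp: maxplus_add_le_iff)

lemma maxplus_member_le_sum:
  fixes f :: "'a \<Rightarrow> maxplus"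
  assumes "finite A" "a \<in> A"
  shows "f a \<le> sum f A"
  using maxplus_sum_le_iff[OF assms(1), of f "sum f A"] assms(2) by simp

lemma maxplus_sum_eq_zero_iff:
  fixes f :: "'a \<Rightarrow> maxplus"
  assumes "finite A"
  shows "sum f A = 0 \<longleftrightarrow> (\<forall>a\<in>A. f a = 0)"
  using maxplus_sum_le_iff[OF assms, of f 0] by simp

lemma maxplus_mult_mono: "a \<le> b \<Longrightarrow> c \<le> d \<Longrightarrow> a * c \<le> b * (d::maxplus)"
  by (cases a; cases b; cases c; cases d) auto

lemma maxplus_mult_right_le_iff: "c \<noteq> 0 \<Longrightarrow> a * c \<le> b * c \<longleftrightarrow> a \<le> (b::maxplus)"
  by (cases a; cases b; cases c) (auto simp: zero_maxplus_def)

lemma maxplus_mult_inverse_le_iff: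
  "b \<noteq> 0 \<Longrightarrow> a * inverse b \<le> d \<longleftrightarrow> a \<le> d * (b::maxplus)"
  by (cases a; cases b; cases d) (auto simp: zero_maxplus_def)

lemma maxplus_le_mult_inverse_iff:
  "b \<noteq> 0 \<Longrightarrow> a \<le> d * inverse b \<longleftrightarrow> b * a \<le> (d::maxplus)"
  by (cases a; cases b; cases d) (auto simp: zero_maxplus_def)

section \<open>Reduction to the row of column maxima\<close>

lemma one_vector_mult_nth: "(1 v* C) $ j = (\<Sum>i\<in>UNIV. C $ i $ j)"
  for C :: "maxplus ^ 'n ^ 'm"
  by (simp add: vector_matrix_mult_def)

lemma regular_one_vector_mult:
  assumes "column_regular C"
  shows "regular (1 v* C)"
  using assms
  by (simp add: column_regular_def regular_def one_vector_mult_nth maxplus_sum_eq_zero_iff)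

lemma scalar_product_one_matrix_vector_mult:
  fixes C :: "maxplus ^ 'n ^ 'm"
  shows "scalar_product 1 (C *v x) = (\<Sum>j\<in>UNIV. (1 v* C) $ j * x $ j)"
proof -
  have "scalar_product 1 (C *v x) = (\<Sum>i\<in>UNIV. \<Sum>j\<in>UNIV. C $ i $ j * x $ j)"
    by (simp add: scalar_product_def matrix_vector_mult_def)
  also have "\<dots> = (\<Sum>j\<in>UNIV. \<Sum>i\<in>UNIV. C $ i $ j * x $ j)"
    by (rule sum.swap)
  finally show ?thesis
    by (simp add: one_vector_mult_nth sum_distrib_right)
qed

text \<open>
  The next two lemmas are associativity for products of a matrix, a column and a row. They
  bring every matrix expression of the problem down to a product of vectors and scalars.
\<close>

lemma matrix_mult_outer_product:
  "C ** outer_product x y = outer_product (C *v x) y"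
  by (simp add: outer_product_def matrix_matrix_mult_def matrix_vector_mult_def vec_eq_iff
      sum_distrib_right mult.assoc)

lemma outer_product_matrix_mult:
  "outer_product x y ** C = outer_product x (y v* C)"
  by (simp add: outer_product_def matrix_matrix_mult_def vector_matrix_mult_def vec_eq_iff
      sum_distrib_left mult_ac)

lemma objective_factorization:
  "objective C x =
    (\<Sum>j\<in>UNIV. (1 v* C) $ j * x $ j) * (\<Sum>k\<in>UNIV. conj_transpose x $ k)"
proof -
  have "objective C x = scalar_product 1 (C *v x) * (\<Sum>k\<in>UNIV. conj_transpose x $ k)"
    unfolding objective_def matrix_mult_outer_product
    by (simp add: scalar_product_def outer_product_def sum_product
        matrix_vector_mult_def)
  then show ?thesis
    by (simp add: scalar_product_one_matrix_vector_mult)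
qed

text \<open>
  Multiplying out the factorization gives the sum of all \<open>c\<^sub>j x\<^sub>j x\<^sub>k\<inverse>\<close>, which is bounded by
  bounding each term; regularity of \<open>x\<close> allows \<open>x\<^sub>k\<close> to be moved to the other side.
\<close>

lemma objective_le_iff:
  assumes "regular x"
  shows "objective C x \<le> d \<longleftrightarrow> (\<forall>j k. (1 v* C) $ j * x $ j \<le> d * x $ k)"
proof -
  have "objective C x =
      (\<Sum>j\<in>UNIV. \<Sum>k\<in>UNIV. (1 v* C) $ j * x $ j * inverse (x $ k))"
    using assms
    by (simp add: objective_factorization sum_product conj_transpose_def regular_def)
  then show ?thesis
    using assms
    by (simp add: maxplus_sum_le_iff maxplus_mult_inverse_le_iff regular_def)
qed

section \<open>Two parametrizations of the solutions\<close>

text \<open>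
  The system \<open>c\<^sub>j x\<^sub>j \<le> d x\<^sub>k\<close> says that every \<open>c\<^sub>j x\<^sub>j\<close> lies below \<open>d\<close> times the least entry of
  \<open>x\<close>, so that entry is a possible \<open>\<alpha>\<close>. Conversely a bound by a real \<open>\<alpha>\<close> from below already
  forces \<open>x\<close> to be regular.
\<close>

lemma regular_bounds_iff:
  assumes "regular c"
  shows "(\<exists>\<alpha>::real. Fin \<alpha> *s 1 \<le> x \<and> x \<le> (Fin \<alpha> * d) *s conj_transpose c) \<longleftrightarrow>
    regular x \<and> (\<forall>j k. c $ j * x $ j \<le> d * x $ k)"
    (is "?bounds \<longleftrightarrow> ?system")
proof -
  have upper: "x \<le> a *s conj_transpose c \<longleftrightarrow> (\<forall>j. c $ j * x $ j \<le> a)" for a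
    using assms
    by (simp add: less_eq_vec_def conj_transpose_def regular_def maxplus_le_mult_inverse_iff)
  show ?thesis
  proof
    assume ?bounds
    then obtain \<alpha> where lower: "\<And>k. Fin \<alpha> \<le> x $ k"
      and le: "\<And>j. c $ j * x $ j \<le> Fin \<alpha> * d"
      unfolding upper by (auto simp: less_eq_vec_def)
    have "c $ j * x $ j \<le> d * x $ k" for j k
    proof -
      have "c $ j * x $ j \<le> d * Fin \<alpha>"
        using le by (simp add: mult.commute)
      also have "\<dots> \<le> d * x $ k"
        by (rule maxplus_mult_mono) (simp_all add: lower)
      finally show ?thesis .
    qed
    moreover have "x $ k \<noteq> 0" for k
      using lower[of k] by auto
    ultimately show ?system
      by (simp add: regular_def)
  next
    assume sys: ?system
    have "Min (range (($) x)) \<in> range (($) x)"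
      by (rule Min_in) auto
    then obtain m where m: "Min (range (($) x)) = x $ m"
      by (rule rangeE)
    then have lower: "x $ m \<le> x $ k" for k
      by (metis Min_le finite finite_imageI rangeI)
    obtain \<alpha> where \<alpha>: "x $ m = Fin \<alpha>"
      using sys maxplus_nonzeroE[of "x $ m"] unfolding regular_def by blast
    have "c $ j * x $ j \<le> Fin \<alpha> * d" for j
      using sys by (metis \<alpha> mult.commute)
    moreover have "Fin \<alpha> *s 1 \<le> x"
      using lower by (simp add: less_eq_vec_def \<alpha>)
    ultimately show ?bounds
      unfolding upper by blast
  qed
qed

lemma identity_plus_outer_product_mult_nth:
  fixes C :: "maxplus ^ 'n ^ 'n"
  shows "((mat 1 + outer_product (a *s 1) 1 ** C) *v u) $ i =
    u $ i + a * (\<Sum>j\<in>UNIV. (1 v* C) $ j * u $ j)"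
proof -
  have "((mat 1 + outer_product (a *s 1) 1 ** C) *v u) $ i =
      u $ i + (outer_product (a *s 1) (1 v* C) *v u) $ i"
    by (simp add: matrix_vector_mult_add_rdistrib outer_product_matrix_mult)
  then show ?thesis
    by (simp add: outer_product_def matrix_vector_mult_def sum_distrib_left mult.assoc)
qed

text \<open>
  With \<open>t = d\<inverse> (\<Sum>\<^sub>j c\<^sub>j u\<^sub>j)\<close>, the vector \<open>x = u \<oplus> t 1\<close> has all entries at least \<open>t\<close>, while
  \<open>c\<^sub>j x\<^sub>j \<le> d t\<close> still holds because \<open>c\<^sub>j \<le> d\<close>. In the other direction the system itself states
  \<open>d\<inverse> (\<Sum>\<^sub>j c\<^sub>j x\<^sub>j) \<le> x\<^sub>k\<close>, so that \<open>u = x\<close> works.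
\<close>

lemma regular_image_iff:
  assumes "\<And>j. c $ j \<le> d" and "d \<noteq> 0"
  shows "(\<exists>u. regular u \<and> (\<forall>i. x $ i = u $ i + inverse d * (\<Sum>j\<in>UNIV. c $ j * u $ j))) \<longleftrightarrow>
    regular x \<and> (\<forall>j k. c $ j * x $ j \<le> d * x $ k)"
    (is "?image \<longleftrightarrow> ?system")
proof
  assume ?image
  then obtain u where u: "regular u"
    and x: "\<And>i. x $ i = u $ i + inverse d * (\<Sum>j\<in>UNIV. c $ j * u $ j)"
    by blast
  define t where "t = inverse d * (\<Sum>j\<in>UNIV. c $ j * u $ j)"
  have "c $ j * u $ j \<le> (\<Sum>j\<in>UNIV. c $ j * u $ j)" for j
    by (rule maxplus_member_le_sum) auto
  moreover have "(\<Sum>j\<in>UNIV. c $ j * u $ j) \<le> d * t"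
    using maxplus_mult_inverse_le_iff[OF assms(2), of "\<Sum>j\<in>UNIV. c $ j * u $ j" t]
    by (simp add: t_def mult.commute)
  ultimately have cu: "c $ j * u $ j \<le> d * t" for j
    by (rule order_trans)
  have "c $ j * x $ j \<le> d * x $ k" for j k
  proof -
    \<comment> \<open>The two terms of \<open>x\<^sub>j = u\<^sub>j \<oplus> t\<close> are bounded separately; the second uses \<open>c\<^sub>j \<le> d\<close>.\<close>
    have "c $ j * x $ j \<le> d * t"
      by (simp add: x t_def[symmetric] distrib_left maxplus_add_le_iff cu
          maxplus_mult_mono assms(1))
    also have "\<dots> \<le> d * x $ k"
      by (rule maxplus_mult_mono) (simp_all add: x t_def[symmetric] plus_maxplus_def)
    finally show ?thesis .
  qed
  moreover have "regular x"
    using u by (auto simp: regular_def x plus_maxplus_def max_def)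
  ultimately show ?system
    by blast
next
  assume sys: ?system
  have "inverse d * (\<Sum>j\<in>UNIV. c $ j * x $ j) \<le> x $ i" for i
  proof -
    have "(\<Sum>j\<in>UNIV. c $ j * x $ j) \<le> x $ i * d"
      using sys by (simp add: maxplus_sum_le_iff mult.commute)
    then show ?thesis
      using assms(2) by (simp add: mult.commute[of "inverse d"] maxplus_mult_inverse_le_iff)
  qed
  \<comment> \<open>A solution is a fixed point of the matrix, so it is its own preimage.\<close>
  then have "\<forall>i. x $ i = x $ i + inverse d * (\<Sum>j\<in>UNIV. c $ j * x $ j)"
    by (simp add: plus_maxplus_def max_absorb1)
  with sys show ?image
    by blast
qed

section \<open>The minimization problem\<close>

theorem theorem10:
  fixes C :: "maxplus ^ 'n ^ 'n" and \<Delta> :: maxplus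
  assumes "column_regular C"
    and "\<Delta> = scalar_product 1 (C *v 1)"
  shows "\<Delta> = mp_norm C
    \<and> (\<exists>x. regular x \<and> objective C x = \<Delta>)
    \<and> (\<forall>x. regular x \<longrightarrow> \<Delta> \<le> objective C x)
    \<and> (\<forall>x. is_arg_min (objective C) regular x \<longleftrightarrow>
          (\<exists>\<alpha>::real. Fin \<alpha> *s 1 \<le> x \<and> x \<le> (Fin \<alpha> * \<Delta>) *s conj_transpose (1 v* C)))
    \<and> (\<forall>x. is_arg_min (objective C) regular x \<longleftrightarrow>
          (\<exists>u. regular u \<and> x = (mat 1 + outer_product (inverse \<Delta> *s 1) 1 ** C) *v u))"
proof -
  define c where "c = 1 v* C"
  have c: "regular c"
    using assms(1) by (simp add: c_def regular_one_vector_mult)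
  have \<Delta>: "\<Delta> = (\<Sum>j\<in>UNIV. c $ j)"
    by (simp add: assms(2) scalar_product_one_matrix_vector_mult c_def)
  have c_le: "c $ j \<le> \<Delta>" for j
    unfolding \<Delta> by (rule maxplus_member_le_sum) auto
  have \<Delta>_nonzero: "\<Delta> \<noteq> 0"
    using c by (simp add: \<Delta> maxplus_sum_eq_zero_iff regular_def)
  have norm: "\<Delta> = mp_norm C"
    by (simp add: assms(2) scalar_product_def matrix_vector_mult_def mp_norm_def)
  have lower: "\<Delta> \<le> objective C x" if "regular x" for x
  proof -
    have "c $ j * x $ j \<le> objective C x * x $ j" for j
      using objective_le_iff[OF that, of C "objective C x"] by (simp add: c_def)
    then have "c $ j \<le> objective C x" for j
      using that by (simp add: regular_def maxplus_mult_right_le_iff)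
    then show ?thesis
      by (simp add: \<Delta> maxplus_sum_le_iff)
  qed
  have regular_1: "regular (1 :: maxplus ^ 'n)"
    by (simp add: regular_def)
  have "objective C 1 \<le> \<Delta>"
    using objective_le_iff[OF regular_1, of C \<Delta>] c_le by (simp add: c_def)
  with lower[OF regular_1] have attained: "objective C 1 = \<Delta>"
    by simp
  have "is_arg_min (objective C) regular x \<longleftrightarrow> regular x \<and> objective C x \<le> \<Delta>" for x
    using lower regular_1 attained
    by (metis is_arg_min_linorder order_trans)
  then have arg_min: "is_arg_min (objective C) regular x \<longleftrightarrow>
      regular x \<and> (\<forall>j k. c $ j * x $ j \<le> \<Delta> * x $ k)" for x
    by (auto simp: objective_le_iff c_def)
  show ?thesis
  proof (intro conjI allI impI)
    show "\<exists>x. regular x \<and> objective C x = \<Delta>"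
      using regular_1 attained by blast
    show "is_arg_min (objective C) regular x \<longleftrightarrow>
        (\<exists>\<alpha>::real. Fin \<alpha> *s 1 \<le> x \<and> x \<le> (Fin \<alpha> * \<Delta>) *s conj_transpose (1 v* C))" for x
      using regular_bounds_iff[OF c, of x \<Delta>] arg_min by (simp add: c_def)
    show "is_arg_min (objective C) regular x \<longleftrightarrow>
        (\<exists>u. regular u \<and> x = (mat 1 + outer_product (inverse \<Delta> *s 1) 1 ** C) *v u)" for x
      using regular_image_iff[OF c_le \<Delta>_nonzero, of x] arg_min
      by (simp add: vec_eq_iff identity_plus_outer_product_mult_nth c_def)
  qed (fact norm lower)+
qed

end
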